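(* Let $1/2\le\lambda\le 1$ and let $f\in\mathcal{F}_0(\lambda)$ with $f(z)=z+\sum_{n=2}^\infty a_nz^n$. Then $$|H_{2,1}(F_f/2)|\le \frac{(2\lambda+1)^2(12\lambda^2-60\lambda-165)}{576(4\lambda^2-12\lambda-39)}.$$ The inequality is sharp, i.e., for each $\lambda\in[1/2,1]$ there is a function $f\in\mathcal{F}_0(\lambda)$ for which equality holds.
   Context: Let $\mathbb{D}=\{z\in\mathbb{C}:|z|<1\}$ and let $\mathcal{A}$ be the class of analytic functions $f$ on $\mathbb{D}$ of the form $f(z)=z+\sum_{n=2}^\infty a_nz^n$. For $1/2\le\lambda\le1$, $\mathcal{F}_0(\lambda)$ denotes the class of locally univalent $f\in\mathcal{A}$ (i.e. $f'(z)\ne0$ on $\mathbb{D}$) such that $$\mathrm{Re}\Big(1+\frac{zf''(z)}{f'(z)}\Big)>\frac12-\lambda\quad\text{for } z\in\mathbb{D}.$$ The logarithmic coefficients $\gamma_n=\gamma_n(f)$ are defined by $F_f(z)=\log\frac{f(z)}{z}=2\sum_{n=1}^\infty\gamma_nz^n$ (branch with value $0$ at $z=0$), and the second Hankel determinant of the logarithmic coefficients is $$H_{2,1}(F_f/2)=\gamma_1\gamma_3-\gamma_2^2=\frac14\Big(a_2a_4-a_3^2+\frac1{12}a_2^4\Big).$$ *)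

theory Defs
  imports "HOL-Complex_Analysis.Complex_Analysis"
begin

abbreviation unit_disk :: "complex set" where
  "unit_disk \<equiv> ball 0 1"

definition class_A :: "(complex \<Rightarrow> complex) set" where
  "class_A = {f. f holomorphic_on unit_disk \<and> f 0 = 0 \<and> deriv f 0 = 1}"

definition class_F0 :: "real \<Rightarrow> (complex \<Rightarrow> complex) set" where
  "class_F0 lam =
     {f \<in> class_A. (\<forall>z\<in>unit_disk. deriv f z \<noteq> 0) \<and>
        (\<forall>z\<in>unit_disk. Re (1 + z * deriv (deriv f) z / deriv f z) > 1 / 2 - lam)}"

text \<open>
  \<open>log_quot f\<close> uses the principal branch of the logarithm. Since \<open>f z / z\<close> tends to \<open>1\<close>
  at the origin for \<open>f\<close> in \<open>class_A\<close>, near the origin it coincides with the analytic branch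
  of \<open>log (f z / z)\<close> that vanishes at the origin; further out the two may differ by a multiple
  of \<open>2 * pi * \<i>\<close>. Only its Taylor coefficients at the origin are used. Lemma
  \<open>log_coeff_sums\<close> shows that they are the coefficients of the branch on the whole disk.
\<close>
definition log_quot :: "(complex \<Rightarrow> complex) \<Rightarrow> complex \<Rightarrow> complex" where
  "log_quot f z = (if z = 0 then 0 else Ln (f z / z))"

definition log_coeff :: "(complex \<Rightarrow> complex) \<Rightarrow> nat \<Rightarrow> complex" where
  "log_coeff f n = (deriv ^^ n) (log_quot f) 0 / fact n / 2"

definition hankel_log_2_1 :: "(complex \<Rightarrow> complex) \<Rightarrow> complex" where
  "hankel_log_2_1 f = log_coeff f 1 * log_coeff f 3 - (log_coeff f 2)\<^sup>2"

lemma class_A_power_series: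
  assumes "f \<in> class_A" "z \<in> unit_disk"
  shows "(\<lambda>n. (deriv ^^ (n + 2)) f 0 / fact (n + 2) * z ^ (n + 2)) sums (f z - z)"
proof -
  have "(\<lambda>n. (deriv ^^ n) f 0 / fact n * (z - 0) ^ n) sums f z"
    using assms by (intro holomorphic_power_series[where r = 1]) (auto simp: class_A_def)
  then have "(\<lambda>n. (deriv ^^ (n + 2)) f 0 / fact (n + 2) * z ^ (n + 2)) sums
      (f z - (\<Sum>n<2. (deriv ^^ n) f 0 / fact n * z ^ n))"
    by (subst sums_iff_shift) simp
  then show ?thesis
    using assms by (simp add: class_A_def numeral_2_eq_2)
qed

lemma log_coeff_sums:
  assumes F: "F holomorphic_on unit_disk" "F 0 = 0"
    and exp_F: "\<And>z. z \<in> unit_disk \<Longrightarrow> z \<noteq> 0 \<Longrightarrow> exp (F z) = f z / z"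
    and z: "z \<in> unit_disk"
  shows "(\<lambda>n. 2 * log_coeff f n * z ^ n) sums F z"
proof -
  have "isCont F 0"
    using F(1) by (intro continuous_on_interior[OF holomorphic_on_imp_continuous_on]) auto
  then have "((\<lambda>w. Im (F w)) \<longlongrightarrow> Im (F 0)) (nhds 0)"
    by (intro tendsto_intros) (simp add: isCont_def tendsto_at_iff_tendsto_nhds)
  then have lim: "((\<lambda>w. Im (F w)) \<longlongrightarrow> 0) (nhds 0)"
    by (simp add: F(2))
  have "\<forall>\<^sub>F w in nhds 0. Im (F w) < pi" "\<forall>\<^sub>F w in nhds 0. - pi < Im (F w)"
    using order_tendstoD[OF lim] by auto
  moreover have "\<forall>\<^sub>F w in nhds 0. w \<in> unit_disk"
    by (rule eventually_nhds_in_open) auto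
  ultimately have "\<forall>\<^sub>F w in nhds 0. log_quot f w = F w"
  proof eventually_elim
    case (elim w)
    then show ?case
      using exp_F[of w] F(2)
      by (cases "w = 0") (auto simp: log_quot_def Ln_exp simp flip: exp_F)
  qed
  then have "(deriv ^^ n) (log_quot f) 0 = (deriv ^^ n) F 0" for n
    by (rule higher_deriv_cong_ev) simp
  moreover have "(\<lambda>n. (deriv ^^ n) F 0 / fact n * (z - 0) ^ n) sums F z"
    using F(1) z by (intro holomorphic_power_series[where r = 1])
  ultimately show ?thesis
    by (simp add: log_coeff_def)
qed

end

theory Submission
  imports Defs
begin

text \<open>
  Put \<open>k = lam + 1/2\<close>. A function \<open>f\<close> of class \<open>F\<^sub>0(lam)\<close> corresponds to a holomorphic
  \<open>\<phi> = b\<^sub>0 + b\<^sub>1 z + b\<^sub>2 z\<^sup>2 + ...\<close> with \<open>|\<phi>| \<le> 1\<close> through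
  \<open>z f'' / f' = 2 k z \<phi> / (1 - z \<phi>)\<close>, and the Hankel determinant becomes \<open>k\<^sup>2 / 144\<close> times a polynomial
  in the \<open>b\<^sub>i\<close>. Two steps of the Schur algorithm give \<open>b\<^sub>1 = (1 - s) x\<close> and
  \<open>b\<^sub>2 = (1 - s) (y - cnj b\<^sub>0 x\<^sup>2)\<close> with \<open>s = |b\<^sub>0|\<^sup>2\<close>, \<open>|x| \<le> 1\<close> and \<open>|y| \<le> 1 - |x|\<^sup>2\<close>. After a
  rotation it remains to bound \<open>|A + B x - c x\<^sup>2| + c (1 - |x|\<^sup>2)\<close> with \<open>A, B, c \<ge> 0\<close> depending on \<open>s\<close>
  and \<open>k\<close>. For small \<open>s\<close> the maximum lies at \<open>x = -1\<close>, where the expression equals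
  \<open>4 + 2 (1 + k) s - (8 + 4 k - k\<^sup>2) s\<^sup>2\<close>; the maximal value of this parabola in \<open>s\<close> is the bound, and
  cruder estimates suffice for larger \<open>s\<close>. Equality holds for \<open>\<phi>(z) = (r - z) / (1 - r z)\<close> with
  \<open>r\<^sup>2 = (1 + k) / (8 + 4 k - k\<^sup>2)\<close>.
\<close>

section \<open>The Schur class and one step of the Schur algorithm\<close>

definition schur_class :: "(complex \<Rightarrow> complex) set" where
  "schur_class = {\<phi>. \<phi> holomorphic_on unit_disk \<and> (\<forall>z\<in>unit_disk. norm (\<phi> z) \<le> 1)}"

text \<open>The Schwarz lemma for \<open>z * \<phi> z\<close>: it gives the bound away from the
  origin, and at the origin the derivative of this product is \<open>\<phi> 0\<close>.\<close>

lemma schur_classI: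
  assumes hol: "\<phi> holomorphic_on unit_disk"
    and lt: "\<And>z. norm z < 1 \<Longrightarrow> norm (z * \<phi> z) < 1"
  shows "\<phi> \<in> schur_class"
proof -
  let ?w = "\<lambda>z. z * \<phi> z"
  have hol_w: "?w holomorphic_on unit_disk"
    by (intro holomorphic_intros hol)
  have "(?w has_field_derivative 1 * \<phi> 0 + deriv \<phi> 0 * 0) (at 0)"
    by (intro DERIV_mult DERIV_ident holomorphic_derivI[OF hol]) auto
  then have deriv_w: "deriv ?w 0 = \<phi> 0"
    by (intro DERIV_imp_deriv) simp
  have "norm (\<phi> z) \<le> 1" if "norm z < 1" for z
  proof (cases "z = 0")
    case True
    then show ?thesis using Schwarz_Lemma(2)[OF hol_w _ lt that] deriv_w by simp
  next
    case False
    then show ?thesis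
      using Schwarz_Lemma(1)[OF hol_w _ lt that] by (simp add: norm_mult)
  qed
  with hol show ?thesis by (simp add: schur_class_def)
qed

text \<open>Moving \<open>\<phi> 0\<close> to the origin by a disk automorphism and dividing by
  \<open>z\<close> stays in the class by the Schwarz lemma. If \<open>\<phi>\<close> reaches modulus
  1, it is constant and \<open>\<psi> = 0\<close> works; the identity is stated with the denominator
  cleared because \<open>1 - cnj (\<phi> 0) * \<phi> z\<close> vanishes then.\<close>

lemma schur_step:
  assumes "\<phi> \<in> schur_class"
  obtains \<psi> where "\<psi> \<in> schur_class"
    "\<And>z. z \<in> unit_disk \<Longrightarrow> \<phi> z - \<phi> 0 = z * \<psi> z * (1 - cnj (\<phi> 0) * \<phi> z)"
proof (cases "\<forall>z\<in>unit_disk. norm (\<phi> z) < 1")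
  case True
  have hol: "\<phi> holomorphic_on unit_disk" using assms by (simp add: schur_class_def)
  have lt: "norm (\<phi> z) < 1" if "norm z < 1" for z using True that by simp
  let ?w = "Moebius_function 0 (\<phi> 0) \<circ> \<phi>"
  have w_lt: "norm (?w z) < 1" if "norm z < 1" for z
    using that by (simp add: Moebius_function_norm_lt_1 lt)
  have "?w holomorphic_on unit_disk"
    by (rule holomorphic_on_compose_gen[OF hol Moebius_function_holomorphic]) (auto simp: lt)
  moreover have "?w 0 = 0" by (simp add: Moebius_function_eq_zero)
  ultimately obtain \<psi> where hol_\<psi>: "\<psi> holomorphic_on unit_disk"
      and w_eq: "\<And>z. norm z < 1 \<Longrightarrow> ?w z = z * \<psi> z"
    using Schwarz3[of ?w 1] by blast
  have \<psi>: "\<psi> \<in> schur_class"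
    using w_lt w_eq by (intro schur_classI hol_\<psi>) metis
  have "\<phi> z - \<phi> 0 = z * \<psi> z * (1 - cnj (\<phi> 0) * \<phi> z)" if "z \<in> unit_disk" for z
  proof -
    have "norm (cnj (\<phi> 0) * \<phi> z) < 1"
      using lt[of 0] lt[of z] that mult_strict_mono[of "norm (\<phi> 0)" 1 "norm (\<phi> z)" 1]
      by (simp add: norm_mult)
    then have "1 - cnj (\<phi> 0) * \<phi> z \<noteq> 0" by force
    then show ?thesis
      using w_eq[of z] that by (simp add: Moebius_function_simple divide_simps)
  qed
  with \<psi> show ?thesis by (rule that)
next
  case False
  then obtain u where u: "u \<in> unit_disk" "norm (\<phi> u) \<ge> 1" by force
  have "norm (\<phi> z) \<le> norm (\<phi> u)" if "z \<in> unit_disk" for z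
    using assms that by (intro order_trans[OF _ u(2)]) (simp add: schur_class_def)
  then have "\<phi> constant_on unit_disk"
    using assms u
    by (intro maximum_modulus_principle[of \<phi> unit_disk unit_disk u])
      (auto simp: schur_class_def)
  then obtain a where a: "\<And>z. z \<in> unit_disk \<Longrightarrow> \<phi> z = a"
    unfolding constant_on_def by blast
  show ?thesis
  proof (rule that)
    show "(\<lambda>_. 0) \<in> schur_class" by (simp add: schur_class_def)
    show "\<phi> z - \<phi> 0 = z * 0 * (1 - cnj (\<phi> 0) * \<phi> z)" if "z \<in> unit_disk" for z
      using a[of 0] a[OF that] by simp
  qed
qed

section \<open>Taylor coefficients of Schur functions\<close>

lemma has_fps_expansion_eqD:
  fixes f g :: "complex \<Rightarrow> complex"
  assumes "f has_fps_expansion F" "g has_fps_expansion G" "\<forall>\<^sub>F z in nhds 0. f z = g z"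
  shows "F = G"
proof (rule fps_ext)
  fix n
  have "(deriv ^^ n) f 0 = (deriv ^^ n) g 0"
    by (rule higher_deriv_cong_ev) (use assms in auto)
  then show "fps_nth F n = fps_nth G n"
    using assms by (simp add: fps_nth_fps_expansion)
qed

lemma eventually_unit_disk: "(\<And>z. z \<in> unit_disk \<Longrightarrow> P z) \<Longrightarrow> \<forall>\<^sub>F z in nhds 0. P z"
  by (rule eventually_mono[OF eventually_nhds_in_open[of unit_disk]]) auto

text \<open>Comparison of the coefficients of \<open>z\<close> and \<open>z^2\<close> in the
  identity of \<open>schur_step\<close>; substituting the first relation into the second brings out
  the common factor.\<close>

lemma schur_coeffs_step:
  assumes "\<phi> \<in> schur_class"
  obtains \<psi> where "\<psi> \<in> schur_class"
    "fps_nth (fps_expansion \<phi> 0) 1 = of_real (1 - (norm (\<phi> 0))\<^sup>2) * \<psi> 0"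
    "fps_nth (fps_expansion \<phi> 0) 2 =
       of_real (1 - (norm (\<phi> 0))\<^sup>2) * (fps_nth (fps_expansion \<psi> 0) 1 - cnj (\<phi> 0) * (\<psi> 0)\<^sup>2)"
proof -
  obtain \<psi> where \<psi>: "\<psi> \<in> schur_class"
    and eq: "\<And>z. z \<in> unit_disk \<Longrightarrow> \<phi> z - \<phi> 0 = z * \<psi> z * (1 - cnj (\<phi> 0) * \<phi> z)"
    using schur_step[OF assms] by blast
  define F where "F = fps_expansion \<phi> 0"
  define G where "G = fps_expansion \<psi> 0"
  have F: "\<phi> has_fps_expansion F" and G: "\<psi> has_fps_expansion G"
    using assms \<psi> unfolding F_def G_def schur_class_def
    by (auto intro!: has_fps_expansion_fps_expansion[of unit_disk])
  have FG: "F - fps_const (\<phi> 0) = fps_X * G * (1 - fps_const (cnj (\<phi> 0)) * F)"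
    by (rule has_fps_expansion_eqD[OF _ _ eventually_unit_disk[OF eq]])
      (rule F G has_fps_expansion_diff has_fps_expansion_mult has_fps_expansion_const
        has_fps_expansion_1 has_fps_expansion_fps_X)+
  have F0: "fps_nth F 0 = \<phi> 0" and G0: "fps_nth G 0 = \<psi> 0"
    by (simp_all add: F_def G_def fps_expansion_def)
  have sq: "of_real (1 - (norm (\<phi> 0))\<^sup>2) = 1 - cnj (\<phi> 0) * \<phi> 0"
    by (simp only: of_real_diff of_real_1 complex_norm_square mult.commute)
  define c where "c = cnj (\<phi> 0)"
  have nth: "fps_nth (F - fps_const (\<phi> 0)) n =
      fps_nth (fps_X * (G * (1 - fps_const c * F))) n" for n
    by (simp only: FG c_def mult.assoc)
  have c1: "fps_nth F 1 = (1 - c * \<phi> 0) * \<psi> 0"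
    using nth[of 1] by (simp add: F0 G0 mult.commute)
  have "fps_nth F 2 = fps_nth G 1 * (1 - c * \<phi> 0) - \<psi> 0 * (c * fps_nth F 1)"
    using nth[of 2] by (simp add: F0 G0 numeral_2_eq_2 fps_mult_nth)
  also have "\<dots> = (1 - c * \<phi> 0) * (fps_nth G 1 - c * (\<psi> 0)\<^sup>2)"
    unfolding c1 by (simp add: algebra_simps power2_eq_square)
  finally have c2: "fps_nth F 2 = (1 - c * \<phi> 0) * (fps_nth G 1 - c * (\<psi> 0)\<^sup>2)" .
  show ?thesis
    using that[OF \<psi>] c1 c2 unfolding sq c_def F_def G_def by blast
qed

text \<open>Here \<open>x\<close> and \<open>y\<close> are the first two coefficients of the first
  Schur iterate; a second step of the algorithm bounds \<open>y\<close>.\<close>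

lemma schur_coeffs:
  assumes "\<phi> \<in> schur_class"
  obtains x y where "norm x \<le> 1" "norm y \<le> 1 - (norm x)\<^sup>2"
    "fps_nth (fps_expansion \<phi> 0) 1 = of_real (1 - (norm (\<phi> 0))\<^sup>2) * x"
    "fps_nth (fps_expansion \<phi> 0) 2 = of_real (1 - (norm (\<phi> 0))\<^sup>2) * (y - cnj (\<phi> 0) * x\<^sup>2)"
proof -
  obtain \<psi> where \<psi>: "\<psi> \<in> schur_class"
    "fps_nth (fps_expansion \<phi> 0) 1 = of_real (1 - (norm (\<phi> 0))\<^sup>2) * \<psi> 0"
    "fps_nth (fps_expansion \<phi> 0) 2 =
       of_real (1 - (norm (\<phi> 0))\<^sup>2) * (fps_nth (fps_expansion \<psi> 0) 1 - cnj (\<phi> 0) * (\<psi> 0)\<^sup>2)"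
    using schur_coeffs_step[OF assms] by blast
  obtain \<rho> where \<rho>: "\<rho> \<in> schur_class"
    "fps_nth (fps_expansion \<psi> 0) 1 = of_real (1 - (norm (\<psi> 0))\<^sup>2) * \<rho> 0"
    using schur_coeffs_step[OF \<psi>(1)] by blast
  have 1: "norm (\<psi> 0) \<le> 1" "norm (\<rho> 0) \<le> 1"
    using \<psi>(1) \<rho>(1) by (auto simp: schur_class_def)
  have nn: "0 \<le> 1 - (norm (\<psi> 0))\<^sup>2"
    using 1(1) by (simp add: power_le_one)
  have "norm (fps_nth (fps_expansion \<psi> 0) 1) = (1 - (norm (\<psi> 0))\<^sup>2) * norm (\<rho> 0)"
    using nn by (simp only: \<rho>(2) norm_mult norm_of_real abs_of_nonneg)
  also have "\<dots> \<le> 1 - (norm (\<psi> 0))\<^sup>2"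
    using nn 1(2) by (rule mult_left_le[rotated])
  finally show ?thesis using 1(1) \<psi>(2,3) that by blast
qed

section \<open>The Hankel determinant in terms of the Schur function\<close>

text \<open>With \<open>h = f z / z\<close> and \<open>L = log h\<close>, the differential equation
  determines the coefficients of \<open>h\<close> from those of \<open>\<phi>\<close>, and
  \<open>h' = h L'\<close> those of \<open>L\<close> from those of \<open>h\<close>. Three
  coefficients of each equation give six polynomial relations; the claim follows by
  elimination.\<close>

lemma hankel_log_2_1_eq:
  assumes f: "f \<in> class_A" and \<phi>: "\<phi> \<in> schur_class"
    and eq: "\<And>z. z \<in> unit_disk \<Longrightarrow>
               deriv (deriv f) z * (1 - z * \<phi> z) = 2 * k * \<phi> z * deriv f z"
  defines "b \<equiv> fps_nth (fps_expansion \<phi> 0)"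
  shows "hankel_log_2_1 f = k\<^sup>2 / 144 *
    (6 * b 0 * b 2 - 4 * (b 1)\<^sup>2 + (4 + 2 * k) * (b 0)\<^sup>2 * b 1 + (2 + 2 * k - k\<^sup>2) * b 0 ^ 4)"
proof -
  have holf: "f holomorphic_on unit_disk" and f0: "f 0 = 0" and f1: "deriv f 0 = 1"
    using f by (auto simp: class_A_def)
  obtain h where h: "h holomorphic_on unit_disk" "\<And>z. norm z < 1 \<Longrightarrow> f z = z * h z" "deriv f 0 = h 0"
    using Schwarz3[OF holf f0] by blast
  have h0: "h 0 = 1" using h(3) f1 by simp
  have "isCont h 0"
    using h(1) by (intro continuous_on_interior[OF holomorphic_on_imp_continuous_on]) auto
  then have "(h \<longlongrightarrow> h 0) (nhds 0)"
    by (simp only: isCont_def tendsto_at_iff_tendsto_nhds)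
  from tendsto_Re[OF this] have "((\<lambda>z. Re (h z)) \<longlongrightarrow> 1) (nhds 0)"
    by (simp add: h0)
  then have "\<forall>\<^sub>F z in nhds 0. 0 < Re (h z)"
    by (rule order_tendstoD) simp
  moreover have "\<forall>\<^sub>F z in nhds 0. z \<in> unit_disk"
    by (rule eventually_nhds_in_open) auto
  ultimately have "\<forall>\<^sub>F z in nhds 0. 0 < Re (h z) \<and> z \<in> unit_disk"
    by (rule eventually_conj)
  then obtain U where U: "open U" "0 \<in> U" "\<And>z. z \<in> U \<Longrightarrow> 0 < Re (h z)" "U \<subseteq> unit_disk"
    unfolding eventually_nhds by blast
  \<comment> \<open>Near the origin \<open>Ln (h z)\<close> is thus holomorphic; it agrees with
    \<open>log_quot f\<close> at the origin too, because \<open>h 0 = 1\<close>.\<close>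
  have slit: "h z \<notin> \<real>\<^sub>\<le>\<^sub>0" if "z \<in> U" for z
    using U(3)[OF that] by (simp add: complex_nonpos_Reals_iff)
  have log_eq: "log_quot f z = Ln (h z)" if "z \<in> U" for z
    using h(2)[of z] that U(4) by (auto simp: log_quot_def h0)
  have "(\<lambda>z. Ln (h z)) holomorphic_on U"
    by (intro holomorphic_intros holomorphic_on_subset[OF h(1) U(4)]) (use slit in auto)
  then have holL: "log_quot f holomorphic_on U"
    by (rule holomorphic_transform) (simp add: log_eq)
  have dL: "deriv h z = h z * deriv (log_quot f) z" if "z \<in> U" for z
  proof -
    have expL: "exp (log_quot f u) = h u" if "u \<in> U" for u
      using U(3)[OF that] by (simp add: log_eq[OF that], intro exp_Ln, force)
    have "((\<lambda>z. exp (log_quot f z)) has_field_derivative exp (log_quot f z) * deriv (log_quot f) z) (at z)"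
      by (rule DERIV_fun_exp[OF holomorphic_derivI[OF holL U(1) that]])
    from has_field_derivative_transform_within_open[OF this U(1) that expL]
    have "(h has_field_derivative h z * deriv (log_quot f) z) (at z)"
      by (simp only: expL[OF that])
    then show ?thesis by (rule DERIV_imp_deriv)
  qed
  define F where "F = fps_expansion f 0"
  define H where "H = fps_expansion h 0"
  define L where "L = fps_expansion (log_quot f) 0"
  define B where "B = fps_expansion \<phi> 0"
  have F: "f has_fps_expansion F" and H: "h has_fps_expansion H"
    and B: "\<phi> has_fps_expansion B"
    using holf h(1) \<phi> unfolding F_def H_def B_def schur_class_def
    by (auto intro!: has_fps_expansion_fps_expansion[of unit_disk])
  have L: "log_quot f has_fps_expansion L"
    unfolding L_def using U(1,2) holL by (rule has_fps_expansion_fps_expansion)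
  have FH: "F = fps_X * H"
    by (rule has_fps_expansion_eqD[OF F has_fps_expansion_mult[OF has_fps_expansion_fps_X H]
          eventually_unit_disk]) (simp add: h(2))
  have HL: "fps_deriv H = H * fps_deriv L"
    by (rule has_fps_expansion_eqD[OF has_fps_expansion_deriv[OF H]
          has_fps_expansion_mult[OF H has_fps_expansion_deriv[OF L]]
          eventually_mono[OF eventually_nhds_in_open[OF U(1,2)] dL]])
  have FB: "fps_deriv (fps_deriv F) * (1 - fps_X * B) = fps_const (2 * k) * B * fps_deriv F"
    by (rule has_fps_expansion_eqD[OF _ _ eventually_unit_disk[OF eq]])
      (rule F B has_fps_expansion_diff has_fps_expansion_mult has_fps_expansion_const
        has_fps_expansion_1 has_fps_expansion_fps_X has_fps_expansion_deriv)+
  have H0: "fps_nth H 0 = 1" by (simp add: H_def fps_expansion_def h0)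
  have nF: "fps_nth F (Suc n) = fps_nth H n" for n by (simp add: FH)
  have nHL: "fps_nth (fps_deriv H) n = fps_nth (H * fps_deriv L) n" for n by (simp only: HL)
  have nFB: "fps_nth (fps_deriv (fps_deriv F) * (1 - fps_X * B)) n =
      fps_nth (fps_const (2 * k) * B * fps_deriv F) n" for n by (simp only: FB)
  define h1 where "h1 = fps_nth H (Suc 0)"
  define h2 where "h2 = fps_nth H (Suc (Suc 0))"
  define h3 where "h3 = fps_nth H (Suc (Suc (Suc 0)))"
  define l1 where "l1 = fps_nth L (Suc 0)"
  define l2 where "l2 = fps_nth L (Suc (Suc 0))"
  define l3 where "l3 = fps_nth L (Suc (Suc (Suc 0)))"
  define b0 where "b0 = fps_nth B 0"
  define b1 where "b1 = fps_nth B (Suc 0)"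
  define b2 where "b2 = fps_nth B (Suc (Suc 0))"
  note defs = h1_def[symmetric] h2_def[symmetric] h3_def[symmetric] l1_def[symmetric]
    l2_def[symmetric] l3_def[symmetric] b0_def[symmetric] b1_def[symmetric] b2_def[symmetric]
  \<comment> \<open>Relations 1 to 3 are the coefficients of orders 0 to 2 of \<open>HL\<close>,
    relations 4 to 6 those of \<open>FB\<close>, rewritten in terms of \<open>H\<close> by
    \<open>nF\<close>.\<close>
  have 1: "l1 = h1"
    using nHL[of 0] by (simp add: H0 defs)
  have 2: "2 * h2 = 2 * l2 + h1 * l1"
    using nHL[of "Suc 0"] by (simp add: H0 defs fps_mult_nth)
  have 3: "3 * h3 = 3 * l3 + h1 * 2 * l2 + h2 * l1"
    using nHL[of "Suc (Suc 0)"] by (simp add: H0 defs fps_mult_nth algebra_simps)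
  have 4: "h1 = k * b0"
    using nFB[of 0] by (simp add: H0 defs nF)
  have 5: "6 * h2 - 2 * h1 * b0 = 2 * k * (b0 * 2 * h1 + b1)"
    using nFB[of "Suc 0"] by (simp add: H0 defs nF fps_mult_nth algebra_simps)
  have 6: "12 * h3 - 6 * h2 * b0 - 2 * h1 * b1 = 2 * k * (b0 * 3 * h2 + b1 * 2 * h1 + b2)"
    using nFB[of "Suc (Suc 0)"] by (simp add: H0 defs nF fps_mult_nth algebra_simps)
  have log_coeff: "log_coeff f n = fps_nth L n / 2" for n
    by (simp add: log_coeff_def fps_nth_fps_expansion[OF L])
  have "hankel_log_2_1 f = l1 / 2 * (l3 / 2) - (l2 / 2)\<^sup>2"
    by (simp add: hankel_log_2_1_def log_coeff l1_def l2_def l3_def numeral_2_eq_2 numeral_3_eq_3)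
  also have "\<dots> = 36 * (l1 * l3 - l2\<^sup>2) / 144"
    by (simp add: field_simps power2_eq_square)
  also have "36 * (l1 * l3 - l2\<^sup>2) = k\<^sup>2 *
    (6 * b0 * b2 - 4 * b1\<^sup>2 + (4 + 2 * k) * b0\<^sup>2 * b1 + (2 + 2 * k - k\<^sup>2) * b0 ^ 4)"
    using 1 2 3 4 5 6 by algebra
  finally show ?thesis
    by (simp add: b_def B_def b0_def b1_def b2_def numeral_2_eq_2)
qed

section \<open>Maximising the quadratic expression over the closed unit disk\<close>

text \<open>
  With \<open>t = |x|\<^sup>2\<close> and \<open>v = Re x\<close> the squared inequality has the form \<open>0 \<le> Q t\<close> with \<open>Q\<close> affine, so
  it is enough to verify it at the two ends of \<open>[v\<^sup>2, 1]\<close>: for real \<open>x\<close>, and on the unit circle.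
\<close>
lemma norm_quadratic_le:
  fixes A B c M :: real and x :: complex
  assumes circle: "\<And>u. \<bar>u\<bar> \<le> 1 \<Longrightarrow> (A + c)\<^sup>2 + B\<^sup>2 + 2 * B * (A - c) * u - 4 * A * c * u\<^sup>2 \<le> M\<^sup>2"
    and upper: "\<And>v. A + c + B * v - 2 * c * v\<^sup>2 \<le> M"
    and lower: "c - A + B \<le> M" and B: "0 \<le> B" and c: "0 \<le> c" "c \<le> M"
    and x: "norm x \<le> 1"
  shows "norm (A + B * x - c * x\<^sup>2) + c * (1 - (norm x)\<^sup>2) \<le> M"
proof -
  define v where "v = Re x"
  define t where "t = (norm x)\<^sup>2"
  \<comment> \<open>\<open>Q r\<close> is \<open>(M - c + c r)^2\<close> minus the squared norm,
    with \<open>r\<close> in place of \<open>|x|^2\<close> and \<open>v\<close> kept fixed; the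
    terms \<open>c^2 r^2\<close> cancel, which makes it affine.\<close>
  define Q where "Q r = (M - c)\<^sup>2 - A\<^sup>2 + r * (2 * (M - c - A) * c - B\<^sup>2)
      - 2 * B * A * v + 2 * B * c * r * v + 4 * A * c * v\<^sup>2" for r
  have v1: "\<bar>v\<bar> \<le> 1" using abs_Re_le_cmod[of x] x by (simp add: v_def)
  have t1: "t \<le> 1" using x by (simp add: t_def power_le_one)
  have im: "(Im x)\<^sup>2 = t - v\<^sup>2" unfolding t_def v_def cmod_power2 by simp
  have tv: "v\<^sup>2 \<le> t" using im zero_le_power2[of "Im x"] by linarith
  have "(norm (A + B * x - c * x\<^sup>2))\<^sup>2 =
      (A + B * v - c * (v\<^sup>2 - (Im x)\<^sup>2))\<^sup>2 + (B - 2 * c * v)\<^sup>2 * (Im x)\<^sup>2"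
    unfolding cmod_power2 v_def by (simp add: power2_eq_square algebra_simps)
  also have "\<dots> = (M - c + c * t)\<^sup>2 - Q t"
    unfolding im Q_def by algebra
  finally have sq: "(norm (A + B * x - c * x\<^sup>2))\<^sup>2 = (M - c + c * t)\<^sup>2 - Q t" .
  have Q1: "0 \<le> Q 1"
    using circle[OF v1] unfolding Q_def by (simp add: power2_eq_square algebra_simps)
  have "B * - 1 \<le> B * v" using v1 B by (intro mult_left_mono) auto
  \<comment> \<open>For real \<open>x\<close> the difference of squares factors;
    \<open>upper\<close> controls one factor, \<open>lower\<close> together with
    \<open>v >= -1\<close> the other.\<close>
  then have "0 \<le> (M - (A + c + B * v - 2 * c * v\<^sup>2)) * (M - c + A + B * v)"
    using upper[of v] lower by (intro mult_nonneg_nonneg) simp_all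
  also have "\<dots> = Q (v\<^sup>2)" unfolding Q_def by algebra
  finally have Qv: "0 \<le> Q (v\<^sup>2)" .
  have "0 \<le> Q t"
  proof (cases "v\<^sup>2 = 1")
    case True
    then show ?thesis using tv t1 Q1 by simp
  next
    case False
    then have "0 < 1 - v\<^sup>2" using tv t1 by simp
    moreover have "(1 - v\<^sup>2) * Q t = (1 - t) * Q (v\<^sup>2) + (t - v\<^sup>2) * Q 1"
      unfolding Q_def by algebra
    moreover have "0 \<le> (1 - t) * Q (v\<^sup>2) + (t - v\<^sup>2) * Q 1"
      using t1 tv Q1 Qv by simp
    ultimately have "0 \<le> (1 - v\<^sup>2) * Q t" by (simp only:)
    then show ?thesis using \<open>0 < 1 - v\<^sup>2\<close> by (simp add: zero_le_mult_iff)
  qed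
  moreover have "0 \<le> M - c + c * t" using c by (simp add: t_def)
  ultimately have "norm (A + B * x - c * x\<^sup>2) \<le> M - c + c * t"
    using power2_le_imp_le[of "norm (A + B * x - c * x\<^sup>2)"] by (simp add: sq)
  then show ?thesis by (simp add: t_def algebra_simps)
qed

text \<open>
  The left-hand side is \<open>|A + B x - c x\<^sup>2|\<^sup>2\<close> for \<open>|x| = 1\<close>, \<open>Re x = u\<close>. It is concave in \<open>u\<close>; for
  \<open>s \<le> 31/100\<close> its vertex is at most \<open>-1\<close>, and for larger \<open>s\<close> even the vertex value
  \<open>(A + c)\<^sup>2 (1 + R)\<close>, decreasing in \<open>s\<close>, is below \<open>M\<^sup>2\<close>.
\<close>
lemma circle_quadratic_le:
  fixes k s u :: real
  assumes k: "1 \<le> k" "k \<le> 3 / 2" and s: "0 \<le> s" "s \<le> 1" and u: "\<bar>u\<bar> \<le> 1"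
  defines "A \<equiv> (2 + 2 * k - k\<^sup>2) * s\<^sup>2" and "B \<equiv> (4 + 2 * k) * s * (1 - s)"
    and "c \<equiv> (1 - s) * (4 + 2 * s)" and "M \<equiv> 4 + (1 + k)\<^sup>2 / (8 + 4 * k - k\<^sup>2)"
  assumes lower: "c - A + B \<le> M"
  shows "(A + c)\<^sup>2 + B\<^sup>2 + 2 * B * (A - c) * u - 4 * A * c * u\<^sup>2 \<le> M\<^sup>2"
proof -
  define \<alpha> where "\<alpha> = 2 + 2 * k - k\<^sup>2"
  have "\<alpha> = 3 - (k - 1)\<^sup>2" by (simp add: \<alpha>_def power2_eq_square algebra_simps)
  then have \<alpha>3: "\<alpha> \<le> 3" by simp
  have "0 \<le> k * (2 - k)" using k by simp
  then have \<alpha>2: "2 \<le> \<alpha>" by (simp add: \<alpha>_def power2_eq_square algebra_simps)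
  have A: "0 \<le> A" and B: "0 \<le> B" and c: "0 \<le> c"
    using \<alpha>2 k s by (simp_all add: A_def B_def c_def \<alpha>_def)
  have Ac: "A + c = 4 - 2 * s + (\<alpha> - 2) * s\<^sup>2"
    unfolding A_def c_def \<alpha>_def by (simp add: power2_eq_square algebra_simps)
  show ?thesis
  proof (cases "s \<le> 31 / 100")
    case True
    have s2: "s\<^sup>2 \<le> (31 / 100) * s"
      using mult_right_mono[OF True s(1)] by (simp only: power2_eq_square)
    have "\<alpha> * s\<^sup>2 \<le> 3 * s\<^sup>2" using \<alpha>3 by (simp add: mult_right_mono)
    then have "4 - 2 * s - 5 * s\<^sup>2 \<le> 4 - 2 * s - (2 + \<alpha>) * s\<^sup>2" by (simp add: algebra_simps)
    also have "\<dots> = c - A" unfolding A_def c_def \<alpha>_def by (simp add: power2_eq_square algebra_simps)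
    finally have cA: "4 - 2 * s - 5 * s\<^sup>2 \<le> c - A" .
    then have cA0: "0 \<le> c - A" and "0 \<le> 4 - 2 * s - 5 * s\<^sup>2" using s2 True by linarith+
    have "4 * A * c = 4 * \<alpha> * s * (4 + 2 * s) * (s * (1 - s))"
      unfolding A_def c_def \<alpha>_def by algebra
    also have "\<dots> \<le> 12 * s * (4 + 2 * s) * (s * (1 - s))"
      using \<alpha>3 s by (intro mult_right_mono) auto
    \<comment> \<open>The inequality reduces to \<open>9 s^2 + 10 s <= 4\<close>, which holds up to
      about 0.312; hence the threshold 31/100. The factor 6 is the least value of
      \<open>4 + 2 k\<close>.\<close>
    also have "\<dots> \<le> 6 * (4 - 2 * s - 5 * s\<^sup>2) * (s * (1 - s))"
    proof (rule mult_right_mono)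
      show "12 * s * (4 + 2 * s) \<le> 6 * (4 - 2 * s - 5 * s\<^sup>2)"
        using s2 True by (simp add: power2_eq_square algebra_simps)
    qed (use s in simp)
    also have "\<dots> \<le> (4 + 2 * k) * (c - A) * (s * (1 - s))"
      using k s cA \<open>0 \<le> 4 - 2 * s - 5 * s\<^sup>2\<close> by (intro mult_right_mono mult_mono) auto
    also have "\<dots> = B * (c - A)" unfolding B_def by algebra
    \<comment> \<open>So the derivative in \<open>u\<close> is nonpositive at \<open>-1\<close>, and
      by concavity the maximum on \<open>[-1, 1]\<close> is the value \<open>(c - A + B)^2\<close>
      at \<open>u = -1\<close>.\<close>
    finally have vertex: "4 * A * c \<le> B * (c - A)" .
    have "4 * A * c * (1 - u) \<le> 4 * A * c * 2"
      using A c u by (intro mult_left_mono) auto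
    then have "0 \<le> (1 + u) * (2 * B * (c - A) - 4 * A * c * (1 - u))"
      using vertex u by (intro mult_nonneg_nonneg) auto
    also have "\<dots> = (c - A + B)\<^sup>2 - ((A + c)\<^sup>2 + B\<^sup>2 + 2 * B * (A - c) * u - 4 * A * c * u\<^sup>2)"
      by algebra
    finally have "(A + c)\<^sup>2 + B\<^sup>2 + 2 * B * (A - c) * u - 4 * A * c * u\<^sup>2 \<le> (c - A + B)\<^sup>2"
      by simp
    also have "\<dots> \<le> M\<^sup>2"
      using lower cA0 B by (intro power_mono) auto
    finally show ?thesis .
  next
    case False
    then have s31: "31 / 100 \<le> s" by simp
    \<comment> \<open>This is \<open>B^2 / (4 A c)\<close> with common factors cancelled, so that it
      makes sense at \<open>s = 1\<close>, where \<open>c = 0\<close>.\<close>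
    define R where "R = (2 + k)\<^sup>2 * (1 - s) / (2 * \<alpha> * (2 + s))"
    have R0: "0 \<le> R" using \<alpha>2 s by (simp add: R_def)
    have "2 * \<alpha> * (2 + s) * R = (2 + k)\<^sup>2 * (1 - s)"
      using \<alpha>2 s by (simp add: R_def)
    moreover have "B\<^sup>2 = 4 * ((2 + k)\<^sup>2 * (1 - s)) * (s\<^sup>2 * (1 - s))"
      unfolding B_def by algebra
    ultimately have B2: "B\<^sup>2 = 4 * A * c * R"
      unfolding A_def c_def \<alpha>_def[symmetric] by algebra
    have sqc: "2 * B * (A - c) * u - 4 * A * c * u\<^sup>2 \<le> R * (A - c)\<^sup>2"
    proof (cases "4 * A * c = 0")
      case True
      then have "B\<^sup>2 = 0" using B2 by simp
      then have "B = 0" by simp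
      with True R0 show ?thesis by auto
    next
      case False
      then have pos: "0 < 4 * A * c" using A c by (simp add: less_le)
      have "4 * A * c * (R * (A - c)\<^sup>2 - (2 * B * (A - c) * u - 4 * A * c * u\<^sup>2)) =
          (4 * A * c * u - B * (A - c))\<^sup>2"
        using B2 by algebra
      then have "0 \<le> 4 * A * c * (R * (A - c)\<^sup>2 - (2 * B * (A - c) * u - 4 * A * c * u\<^sup>2))"
        by simp
      then show ?thesis using pos by (simp add: zero_le_mult_iff)
    qed
    have "(A + c)\<^sup>2 + B\<^sup>2 + 2 * B * (A - c) * u - 4 * A * c * u\<^sup>2
        \<le> (A + c)\<^sup>2 + 4 * A * c * R + R * (A - c)\<^sup>2"
      using sqc B2 by linarith
    also have "\<dots> = (A + c)\<^sup>2 * (1 + R)" by algebra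
    \<comment> \<open>Estimates at the end \<open>s = 31/100\<close>:
      \<open>3 + 0.69^2 < 3.477\<close> for \<open>A + c\<close>, and a linear majorant in
      \<open>k\<close> for \<open>1 + R\<close>.\<close>
    also have "\<dots> \<le> (3477 / 1000)\<^sup>2 * (102 / 100 + 435 / 1000 * k)"
    proof (rule mult_mono)
      have "(\<alpha> - 2) * s\<^sup>2 \<le> 1 * s\<^sup>2" using \<alpha>3 by (intro mult_right_mono) auto
      then have "A + c \<le> 3 + (1 - s)\<^sup>2"
        unfolding Ac by (simp add: power2_eq_square algebra_simps)
      also have "(1 - s)\<^sup>2 \<le> (69 / 100)\<^sup>2" using s s31 by (intro power_mono) auto
      finally have "A + c \<le> 3477 / 1000" by (simp add: power2_eq_square)
      then show "(A + c)\<^sup>2 \<le> (3477 / 1000)\<^sup>2" using A c by (intro power_mono) auto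
      have \<alpha>pos: "0 < 2 * \<alpha> * (231 / 100)" using \<alpha>2 by simp
      \<comment> \<open>The cubic in \<open>k\<close> is divided by
        \<open>(k - 1) (3/2 - k)\<close>; quotient and linear remainder are arranged to be
        nonnegative on \<open>[1, 3/2]\<close>.\<close>
      have "(k - 1) * (3 / 2 - k) * (20097 / 10000 * k + 178725 / 100000) \<ge> 0"
        using k by (intro mult_nonneg_nonneg) auto
      moreover have "(2 / 100 + 435 / 1000 * k) * (2 * \<alpha> * (231 / 100)) - (2 + k)\<^sup>2 * (69 / 100) =
          (k - 1) * (3 / 2 - k) * (20097 / 10000 * k + 178725 / 100000)
          + (105675 - 9375 * k) / 1000000"
        unfolding \<alpha>_def by algebra
      moreover have "0 \<le> (105675 - 9375 * k) / 1000000" using k by simp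
      ultimately have "0 \<le> (2 / 100 + 435 / 1000 * k) * (2 * \<alpha> * (231 / 100)) - (2 + k)\<^sup>2 * (69 / 100)"
        by (simp only: add_nonneg_nonneg)
      then have "(2 + k)\<^sup>2 * (69 / 100) \<le> (2 / 100 + 435 / 1000 * k) * (2 * \<alpha> * (231 / 100))"
        by (simp only: diff_ge_0_iff_ge)
      then have "(2 + k)\<^sup>2 * (69 / 100) / (2 * \<alpha> * (231 / 100)) \<le> 2 / 100 + 435 / 1000 * k"
        by (simp only: pos_divide_le_eq[OF \<alpha>pos])
      moreover have "R \<le> (2 + k)\<^sup>2 * (69 / 100) / (2 * \<alpha> * (231 / 100))"
        unfolding R_def using \<alpha>2 s31 s by (intro frac_le mult_left_mono) auto
      ultimately show "1 + R \<le> 102 / 100 + 435 / 1000 * k" by simp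
    qed (use R0 in auto)
    also have "\<dots> \<le> (161 / 40 + k / 3)\<^sup>2"
      using k mult_mono[of 1 k 1 k] by (simp add: power2_eq_square algebra_simps)
    also have "\<dots> \<le> M\<^sup>2"
    proof (rule power_mono)
      have d: "0 < 8 + 4 * k - k\<^sup>2"
        using \<alpha>2 k by (simp add: \<alpha>_def)
      \<comment> \<open>The linear minorant of \<open>M\<close> is nearly its tangent at
        \<open>k = 5/4\<close>, the midpoint of the range; hence the square below.\<close>
      have "(1 / 40 + k / 3) * (8 + 4 * k - k\<^sup>2) \<le> (1 + k)\<^sup>2"
      proof -
        have "0 \<le> (k - 5 / 4)\<^sup>2 * (k / 3 + 21 / 40)" using k by simp
        then show ?thesis using k by (simp add: power2_eq_square algebra_simps)
      qed
      then have "1 / 40 + k / 3 \<le> (1 + k)\<^sup>2 / (8 + 4 * k - k\<^sup>2)"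
        using d by (simp add: le_divide_eq)
      then show "161 / 40 + k / 3 \<le> M" by (simp add: M_def)
    qed (use k in simp)
    finally show ?thesis .
  qed
qed

text \<open>Checks the hypotheses of \<open>norm_quadratic_le\<close>. Only \<open>lower\<close> and
  \<open>circle\<close> need the full bound; \<open>upper\<close> and \<open>cM\<close> hold already
  with 4 in its place.\<close>

lemma schur_quadratic_le:
  fixes k s :: real and x :: complex
  assumes k: "1 \<le> k" "k \<le> 3 / 2" and s: "0 \<le> s" "s \<le> 1" and x: "norm x \<le> 1"
  defines "A \<equiv> (2 + 2 * k - k\<^sup>2) * s\<^sup>2" and "B \<equiv> (4 + 2 * k) * s * (1 - s)"
    and "c \<equiv> (1 - s) * (4 + 2 * s)"
  shows "norm (A + B * x - c * x\<^sup>2) + c * (1 - (norm x)\<^sup>2)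
      \<le> 4 + (1 + k)\<^sup>2 / (8 + 4 * k - k\<^sup>2)" (is "_ \<le> ?M")
proof -
  have "0 \<le> k * (2 - k)" using k by simp
  then have "k\<^sup>2 \<le> 2 * k" by (simp add: power2_eq_square algebra_simps)
  then have d: "0 < 8 + 4 * k - k\<^sup>2" and \<alpha>2: "2 \<le> 2 + 2 * k - k\<^sup>2"
    using k by simp_all
  have M4: "4 \<le> ?M" using d by simp
  have B: "0 \<le> B" and c: "0 \<le> c"
    using k s by (simp_all add: B_def c_def)
  \<comment> \<open>Completing the square in \<open>s\<close>; the square vanishes at the extremal
    \<open>s\<close>.\<close>
  have "((8 + 4 * k - k\<^sup>2) * s - (1 + k))\<^sup>2 =
      (8 + 4 * k - k\<^sup>2) * ((8 + 4 * k - k\<^sup>2) * s\<^sup>2 - 2 * (1 + k) * s) + (1 + k)\<^sup>2"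
    by algebra
  then have "- (1 + k)\<^sup>2 \<le> (8 + 4 * k - k\<^sup>2) * ((8 + 4 * k - k\<^sup>2) * s\<^sup>2 - 2 * (1 + k) * s)"
    using zero_le_power2[of "(8 + 4 * k - k\<^sup>2) * s - (1 + k)"] by linarith
  then have "- (1 + k)\<^sup>2 / (8 + 4 * k - k\<^sup>2) \<le> (8 + 4 * k - k\<^sup>2) * s\<^sup>2 - 2 * (1 + k) * s"
    using d by (simp only: pos_divide_le_eq mult.commute)
  moreover have "c - A + B = 4 - ((8 + 4 * k - k\<^sup>2) * s\<^sup>2 - 2 * (1 + k) * s)"
    unfolding A_def B_def c_def by algebra
  ultimately have lower: "c - A + B \<le> ?M"
    unfolding minus_divide_left[symmetric] by linarith
  have "2 * s\<^sup>2 \<ge> 0" by simp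
  then have cM: "c \<le> ?M"
    using M4 s unfolding c_def by (simp add: power2_eq_square algebra_simps)
  have upper: "A + c + B * v - 2 * c * v\<^sup>2 \<le> ?M" for v
  proof -
    have "0 \<le> (k - 1)\<^sup>2 * s\<^sup>2" by simp
    then have Ac: "A + c \<le> 4 - 2 * s + s\<^sup>2"
      unfolding A_def c_def by (simp add: power2_eq_square algebra_simps)
    have "(4 + 2 * k) * (s * v) \<le> (4 + 2 * k) * \<bar>s * v\<bar>"
      using k by (intro mult_left_mono) auto
    also have "\<dots> \<le> 7 * \<bar>s * v\<bar>"
      using k by (intro mult_right_mono) auto
    finally have "(4 + 2 * k) * (s * v) \<le> 7 * \<bar>s * v\<bar>" .
    \<comment> \<open>The weights are chosen so that \<open>8 v^2\<close> is absorbed by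
      \<open>2 (4 + 2 s) v^2\<close>.\<close>
    moreover have "7 * \<bar>s * v\<bar> \<le> 8 * v\<^sup>2 + 49 / 32 * s\<^sup>2"
      using zero_le_power2[of "8 * \<bar>v\<bar> - 7 / 2 * s"] s
      by (simp add: power2_eq_square algebra_simps abs_mult)
    moreover have "0 \<le> 4 * s * v\<^sup>2" using s by simp
    ultimately have "(4 + 2 * k) * (s * v) - 2 * (4 + 2 * s) * v\<^sup>2 \<le> 49 / 32 * s\<^sup>2"
      by (simp add: algebra_simps)
    then have "(1 - s) * ((4 + 2 * k) * (s * v) - 2 * (4 + 2 * s) * v\<^sup>2) \<le> (1 - s) * (49 / 32 * s\<^sup>2)"
      using s by (intro mult_left_mono) auto
    also have "(1 - s) * ((4 + 2 * k) * (s * v) - 2 * (4 + 2 * s) * v\<^sup>2) = B * v - 2 * c * v\<^sup>2"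
      unfolding B_def c_def by algebra
    also have "(1 - s) * (49 / 32 * s\<^sup>2) = 49 / 32 * s * (s * (1 - s))" by algebra
    also have "\<dots> \<le> 49 / 32 * s * (1 / 4)"
      using s zero_le_power2[of "s - 1 / 2"]
      by (intro mult_left_mono) (simp_all add: power2_eq_square algebra_simps)
    finally have "B * v - 2 * c * v\<^sup>2 \<le> 49 / 128 * s" by simp
    moreover have "s\<^sup>2 \<le> s" using s by (simp add: power2_eq_square mult_left_le)
    ultimately show ?thesis using Ac M4 s by linarith
  qed
  have circle: "(A + c)\<^sup>2 + B\<^sup>2 + 2 * B * (A - c) * u - 4 * A * c * u\<^sup>2 \<le> ?M\<^sup>2"
    if "\<bar>u\<bar> \<le> 1" for u
    unfolding A_def B_def c_def
    by (rule circle_quadratic_le[OF k s that lower[unfolded A_def B_def c_def]])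
  show ?thesis
    by (rule norm_quadratic_le[OF circle upper lower B c cM x])
qed

section \<open>Correspondence between \<open>class_F0\<close> and the Schur class\<close>

text \<open>The half plane consists of the points nearer to \<open>0\<close> than to
  \<open>-2 k\<close>.\<close>

lemma Re_gt_iff_norm_less:
  fixes q :: complex and k :: real
  assumes "0 < k"
  shows "- k < Re q \<longleftrightarrow> norm q < norm (2 * of_real k + q)"
proof -
  have "(norm (2 * of_real k + q))\<^sup>2 - (norm q)\<^sup>2 = 4 * k * (k + Re q)"
    unfolding cmod_power2 by (simp add: power2_eq_square algebra_simps)
  moreover have "norm q < norm (2 * of_real k + q) \<longleftrightarrow> (norm q)\<^sup>2 < (norm (2 * of_real k + q))\<^sup>2"
    using power_less_imp_less_base[of "norm q" 2] power_strict_mono[of "norm q" "norm (2 * of_real k + q)" 2]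
    by auto
  moreover have "0 < 4 * k * (k + Re q) \<longleftrightarrow> 0 < k + Re q"
    using assms by (simp add: zero_less_mult_iff)
  ultimately show ?thesis by linarith
qed

text \<open>For \<open>q = z f'' / f'\<close> the map \<open>q / (2 k + q)\<close> sends the half
  plane into the disk and equals \<open>z \<phi>\<close>. Writing \<open>\<phi>\<close> as
  \<open>f'' / E\<close> avoids a division by \<open>z\<close>.\<close>

lemma class_F0_imp_schur:
  fixes k :: real
  assumes f: "f \<in> class_F0 (k - 1 / 2)" and k: "0 < k"
  obtains \<phi> where "\<phi> \<in> schur_class"
    "\<And>z. z \<in> unit_disk \<Longrightarrow> deriv (deriv f) z * (1 - z * \<phi> z) = 2 * of_real k * \<phi> z * deriv f z"
proof -
  have hol: "f holomorphic_on unit_disk" and nz: "\<And>z. z \<in> unit_disk \<Longrightarrow> deriv f z \<noteq> 0"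
    and Re: "\<And>z. z \<in> unit_disk \<Longrightarrow> - k < Re (z * deriv (deriv f) z / deriv f z)"
    using f by (auto simp: class_F0_def class_A_def)
  have hol': "deriv f holomorphic_on unit_disk" "deriv (deriv f) holomorphic_on unit_disk"
    by (intro holomorphic_deriv hol open_ball)+
  define E where "E z = 2 * of_real k * deriv f z + z * deriv (deriv f) z" for z
  have E: "E z \<noteq> 0" "norm (z * deriv (deriv f) z / E z) < 1" if z: "z \<in> unit_disk" for z
  proof -
    define q where "q = z * deriv (deriv f) z / deriv f z"
    have qE: "E z = deriv f z * (2 * of_real k + q)" "z * deriv (deriv f) z = deriv f z * q"
      using nz[OF z] by (simp_all add: E_def q_def algebra_simps)
    have less: "norm q < norm (2 * of_real k + q)"
      using Re[OF z] k by (simp only: Re_gt_iff_norm_less q_def)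
    then have "2 * of_real k + q \<noteq> 0" by auto
    then show "E z \<noteq> 0" using nz[OF z] qE by simp
    have "z * deriv (deriv f) z / E z = q / (2 * of_real k + q)"
      using nz[OF z] unfolding qE by simp
    then show "norm (z * deriv (deriv f) z / E z) < 1"
      using less by (simp add: norm_divide divide_less_eq)
  qed
  define \<phi> where "\<phi> z = deriv (deriv f) z / E z" for z
  have hol\<phi>: "\<phi> holomorphic_on unit_disk"
    unfolding \<phi>_def using E(1) unfolding E_def by (intro holomorphic_intros hol') auto
  show ?thesis
  proof (rule that)
    show "\<phi> \<in> schur_class"
      using E(2) by (intro schur_classI hol\<phi>) (simp add: \<phi>_def)
  next
    fix z :: complex
    assume z: "z \<in> unit_disk"
    show "deriv (deriv f) z * (1 - z * \<phi> z) = 2 * of_real k * \<phi> z * deriv f z"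
      unfolding \<phi>_def using E(1)[OF z]
      by (simp add: divide_simps) (simp add: E_def algebra_simps)
  qed
qed

text \<open>Two integrations solve the equation: first for \<open>log f'\<close>, so that
  \<open>f'\<close> is an exponential and has no zeros, then for \<open>f\<close>.\<close>

lemma schur_imp_class_F0:
  fixes k :: real
  assumes \<phi>: "\<phi> \<in> schur_class" and k: "0 < k"
  obtains f where "f \<in> class_F0 (k - 1 / 2)"
    "\<And>z. z \<in> unit_disk \<Longrightarrow> deriv (deriv f) z * (1 - z * \<phi> z) = 2 * of_real k * \<phi> z * deriv f z"
proof -
  have less: "norm (z * \<phi> z) < 1" if "z \<in> unit_disk" for z
    using \<phi> that mult_left_le[of "norm (\<phi> z)" "norm z"] by (auto simp: schur_class_def norm_mult)
  then have nz: "1 - z * \<phi> z \<noteq> 0" if "z \<in> unit_disk" for z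
    using that by force
  have "(\<lambda>z. 2 * of_real k * \<phi> z / (1 - z * \<phi> z)) holomorphic_on unit_disk"
    using \<phi> nz by (auto simp: schur_class_def intro!: holomorphic_intros)
  then obtain l where "\<And>z. z \<in> unit_disk \<Longrightarrow>
      (l has_field_derivative 2 * of_real k * \<phi> z / (1 - z * \<phi> z)) (at z within unit_disk)"
    using holomorphic_convex_primitive'[OF convex_ball open_ball] by blast
  then have l: "(l has_field_derivative 2 * of_real k * \<phi> z / (1 - z * \<phi> z)) (at z)"
    if "z \<in> unit_disk" for z
    using that by (simp add: at_within_open[of _ unit_disk])
  define g where "g z = exp (l z - l 0)" for z
  have g: "(g has_field_derivative g z * (2 * of_real k * \<phi> z / (1 - z * \<phi> z))) (at z)"
    if "z \<in> unit_disk" for z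
    unfolding g_def using l[OF that] by (auto intro!: derivative_eq_intros)
  then have "g holomorphic_on unit_disk"
    unfolding holomorphic_on_open[OF open_ball] by blast
  then obtain F where "\<And>z. z \<in> unit_disk \<Longrightarrow> (F has_field_derivative g z) (at z within unit_disk)"
    using holomorphic_convex_primitive'[OF convex_ball open_ball] by blast
  then have F: "(F has_field_derivative g z) (at z)" if "z \<in> unit_disk" for z
    using that by (simp add: at_within_open[of _ unit_disk])
  define f where "f z = F z - F 0" for z
  have f: "(f has_field_derivative g z) (at z)" if "z \<in> unit_disk" for z
    unfolding f_def using F[OF that] by (auto intro!: derivative_eq_intros)
  then have hol: "f holomorphic_on unit_disk"
    unfolding holomorphic_on_open[OF open_ball] by blast
  have df: "deriv f z = g z" if "z \<in> unit_disk" for z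
    using f[OF that] by (rule DERIV_imp_deriv)
  have ddf: "deriv (deriv f) z = g z * (2 * of_real k * \<phi> z / (1 - z * \<phi> z))" if "z \<in> unit_disk" for z
    by (rule DERIV_imp_deriv, rule has_field_derivative_transform_within_open[OF g[OF that] open_ball that])
      (simp add: df)
  have Re: "- k < Re (z * deriv (deriv f) z / deriv f z)" if z: "z \<in> unit_disk" for z
  proof -
    define q where "q = z * deriv (deriv f) z / deriv f z"
    have "q = 2 * of_real k * (z * \<phi> z) / (1 - z * \<phi> z)"
      using z by (simp add: q_def df ddf g_def)
    then have q: "q = z * \<phi> z * (2 * of_real k + q)"
      using nz[OF z] by (simp add: field_simps)
    have "2 * of_real k + q \<noteq> 0"
    proof
      assume "2 * of_real k + q = 0"
      with q have "q = 0" by simp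
      with \<open>2 * of_real k + q = 0\<close> k show False by simp
    qed
    then have "norm (z * \<phi> z) * norm (2 * of_real k + q) < 1 * norm (2 * of_real k + q)"
      using less[OF z] by (intro mult_strict_right_mono) auto
    then have "norm q < norm (2 * of_real k + q)"
      using q by (metis norm_mult mult_1)
    then show ?thesis using k by (simp only: Re_gt_iff_norm_less q_def)
  qed
  have "f \<in> class_F0 (k - 1 / 2)"
    using hol Re by (auto simp: class_F0_def class_A_def df g_def f_def)
  moreover have "deriv (deriv f) z * (1 - z * \<phi> z) = 2 * of_real k * \<phi> z * deriv f z"
    if "z \<in> unit_disk" for z
    using nz[OF that] by (simp add: df[OF that] ddf[OF that])
  ultimately show ?thesis by (rule that)
qed

section \<open>The sharp bound for the coefficient functional\<close>

text \<open>Substituting \<open>x = e x'\<close> pulls \<open>e^2\<close> out of all terms without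
  \<open>y\<close> and leaves a quadratic in \<open>x'\<close> with real coefficients; the triangle
  inequality splits off \<open>y\<close>.\<close>

lemma schur_functional_le:
  fixes k :: real
  assumes \<phi>: "\<phi> \<in> schur_class" and k: "1 \<le> k" "k \<le> 3 / 2"
  defines "b \<equiv> fps_nth (fps_expansion \<phi> 0)"
  shows "norm (6 * b 0 * b 2 - 4 * (b 1)\<^sup>2 + (4 + 2 * of_real k) * (b 0)\<^sup>2 * b 1
      + (2 + 2 * of_real k - (of_real k)\<^sup>2) * b 0 ^ 4) \<le> 4 + (1 + k)\<^sup>2 / (8 + 4 * k - k\<^sup>2)"
proof -
  define r where "r = norm (b 0)"
  define s where "s = r\<^sup>2"
  have b0: "b 0 = \<phi> 0" by (simp add: b_def fps_expansion_def)
  obtain x y where xy: "norm x \<le> 1" "norm y \<le> 1 - (norm x)\<^sup>2"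
    and b1: "b 1 = of_real (1 - s) * x" and b2: "b 2 = of_real (1 - s) * (y - cnj (b 0) * x\<^sup>2)"
    using schur_coeffs[OF \<phi>] unfolding b_def[symmetric] b0[symmetric] r_def s_def by metis
  have r: "0 \<le> r" "r \<le> 1"
    using \<phi> by (auto simp: r_def b0 schur_class_def)
  then have s: "0 \<le> s" "s \<le> 1" by (simp_all add: s_def power_le_one)
  \<comment> \<open>The square of the phase of \<open>b 0\<close>; for \<open>b 0 = 0\<close> any
    unimodular number serves.\<close>
  define e where "e = (if s = 0 then 1 else (b 0)\<^sup>2 / of_real s)"
  have e: "norm e = 1" "(b 0)\<^sup>2 = of_real s * e"
    by (auto simp: e_def norm_divide norm_power s_def r_def)
  define x' where "x' = cnj e * x"
  have "e * cnj e = 1" using e(1) by (simp flip: complex_norm_square)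
  then have x: "x = e * x'" by (simp add: x'_def mult.assoc[symmetric])
  have nx: "norm x' = norm x" using e(1) by (simp add: x'_def norm_mult)
  have cnj: "b 0 * cnj (b 0) = of_real s" by (simp only: s_def r_def complex_norm_square)
  define A where "A = (2 + 2 * k - k\<^sup>2) * s\<^sup>2"
  define B where "B = (4 + 2 * k) * s * (1 - s)"
  define c where "c = (1 - s) * (4 + 2 * s)"
  have "b 0 ^ 4 = ((b 0)\<^sup>2)\<^sup>2" by simp
  then have "6 * b 0 * b 2 - 4 * (b 1)\<^sup>2 + (4 + 2 * of_real k) * (b 0)\<^sup>2 * b 1
      + (2 + 2 * of_real k - (of_real k)\<^sup>2) * b 0 ^ 4
      = 6 * b 0 * of_real (1 - s) * y + e\<^sup>2 * (A + B * x' - c * x'\<^sup>2)"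
    using cnj e(2) unfolding b1 b2 x A_def B_def c_def
    by (simp only: of_real_mult of_real_add of_real_diff of_real_power of_real_1 of_real_numeral) algebra
  also have "norm \<dots> \<le> 6 * r * (1 - s) * norm y + norm (A + B * x' - c * x'\<^sup>2)"
    using e(1) s
    by (intro order_trans[OF norm_triangle_ineq]) (simp add: norm_mult norm_power r_def del: of_real_diff)
  also have "6 * r * (1 - s) * norm y \<le> c * (1 - (norm x')\<^sup>2)"
  proof (rule mult_mono)
    \<comment> \<open>As \<open>4 + 2 r^2 - 6 r = 2 (1 - r) (2 - r)\<close>, the \<open>y\<close>
      term fits into \<open>c (1 - |x'|^2)\<close>.\<close>
    have "0 \<le> 2 * (1 - r) * (2 - r)" using r by simp
    then have "6 * r \<le> 4 + 2 * s" by (simp add: s_def power2_eq_square algebra_simps)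
    then show "6 * r * (1 - s) \<le> c"
      using s unfolding c_def by (subst (2) mult.commute) (rule mult_right_mono, auto)
  qed (use xy nx s in \<open>auto simp: c_def\<close>)
  also have "c * (1 - (norm x')\<^sup>2) + norm (A + B * x' - c * x'\<^sup>2)
      \<le> 4 + (1 + k)\<^sup>2 / (8 + 4 * k - k\<^sup>2)"
    using schur_quadratic_le[OF k s xy(1)[folded nx]] unfolding A_def B_def c_def
    by (simp only: add.commute)
  finally show ?thesis by simp
qed

text \<open>The disk automorphism has Schur parameters \<open>x = -1\<close>, \<open>y = 0\<close>,
  and \<open>s\<close> is the maximiser of the parabola, so all estimates become equalities.\<close>

lemma schur_functional_attained:
  fixes k :: real
  assumes k: "1 \<le> k" "k \<le> 3 / 2"
  obtains \<phi> where "\<phi> \<in> schur_class" and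
    "let b = fps_nth (fps_expansion \<phi> 0) in
      6 * b 0 * b 2 - 4 * (b 1)\<^sup>2 + (4 + 2 * of_real k) * (b 0)\<^sup>2 * b 1
      + (2 + 2 * of_real k - (of_real k)\<^sup>2) * b 0 ^ 4 = - of_real (4 + (1 + k)\<^sup>2 / (8 + 4 * k - k\<^sup>2))"
proof -
  define d where "d = 8 + 4 * k - k\<^sup>2"
  define s where "s = (1 + k) / d"
  define r where "r = sqrt s"
  have "k\<^sup>2 \<le> (3 / 2)\<^sup>2" using k by (intro power_mono) auto
  then have d: "1 + k < d" using k by (simp add: d_def power2_eq_square)
  then have s: "0 \<le> s" "s < 1" using k by (simp_all add: s_def)
  then have r: "0 \<le> r" "r < 1" "r\<^sup>2 = s" by (simp_all add: r_def real_sqrt_lt_1_iff)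
  define \<phi> where "\<phi> z = - Moebius_function 0 (of_real r) z" for z
  have \<phi>: "\<phi> \<in> schur_class"
    using r Moebius_function_norm_lt_1[of "of_real r"]
      holomorphic_on_minus[OF Moebius_function_holomorphic[of "of_real r" 0]]
    by (auto simp: schur_class_def \<phi>_def[abs_def] intro!: less_imp_le)
  have eq: "\<phi> z * (1 - of_real r * z) = of_real r - z" if "z \<in> unit_disk" for z
  proof -
    have "norm (of_real r * z) < 1"
      using r that mult_left_le[of r "norm z"] by (auto simp: norm_mult mult.commute)
    then have "1 - of_real r * z \<noteq> 0" by force
    then show ?thesis by (simp add: \<phi>_def Moebius_function_simple)
  qed
  define P where "P = fps_expansion \<phi> 0"
  have P: "\<phi> has_fps_expansion P"
    using \<phi> by (auto simp: P_def schur_class_def intro!: has_fps_expansion_fps_expansion[of unit_disk])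
  have "P * (1 - fps_const (of_real r) * fps_X) = fps_const (of_real r) - fps_X"
    by (rule has_fps_expansion_eqD[OF _ _ eventually_unit_disk[OF eq]])
      (rule P has_fps_expansion_diff has_fps_expansion_mult has_fps_expansion_const
        has_fps_expansion_1 has_fps_expansion_fps_X)+
  then have nth: "fps_nth (P * (1 - fps_const (of_real r) * fps_X)) n =
      fps_nth (fps_const (of_real r) - fps_X) n" for n by simp
  have P0: "fps_nth P 0 = of_real r" using nth[of 0] by simp
  have P1: "fps_nth P 1 = (of_real r)\<^sup>2 - 1"
    using nth[of 1] by (simp add: fps_mult_nth P0 power2_eq_square algebra_simps)
  have P2: "fps_nth P 2 = of_real r * fps_nth P 1"
    using nth[of 2] by (simp add: fps_mult_nth numeral_2_eq_2 algebra_simps)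
  have "6 * fps_nth P 0 * fps_nth P 2 - 4 * (fps_nth P 1)\<^sup>2
      + (4 + 2 * of_real k) * (fps_nth P 0)\<^sup>2 * fps_nth P 1
      + (2 + 2 * of_real k - (of_real k)\<^sup>2) * fps_nth P 0 ^ 4
      = of_real (6 * r\<^sup>2 * (r\<^sup>2 - 1) - 4 * (r\<^sup>2 - 1)\<^sup>2 + (4 + 2 * k) * r\<^sup>2 * (r\<^sup>2 - 1)
        + (2 + 2 * k - k\<^sup>2) * (r\<^sup>2)\<^sup>2)"
    unfolding P2 P1 P0 by (simp add: power2_eq_square power4_eq_xxxx mult_ac)
  also have "6 * r\<^sup>2 * (r\<^sup>2 - 1) - 4 * (r\<^sup>2 - 1)\<^sup>2 + (4 + 2 * k) * r\<^sup>2 * (r\<^sup>2 - 1)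
        + (2 + 2 * k - k\<^sup>2) * (r\<^sup>2)\<^sup>2 = d * s\<^sup>2 - 2 * (1 + k) * s - 4"
    unfolding r(3) d_def by algebra
  also have "\<dots> = - (4 + (1 + k)\<^sup>2 / d)"
    using d k by (simp add: s_def power2_eq_square field_simps)
  finally show ?thesis
    using that[OF \<phi>] by (simp add: Let_def P_def d_def)
qed

theorem theorem3p5:
  fixes lam :: real
  assumes "1 / 2 \<le> lam" and "lam \<le> 1"
  shows "(\<forall>f \<in> class_F0 lam.
            norm (hankel_log_2_1 f) \<le>
              (2 * lam + 1)\<^sup>2 * (12 * lam\<^sup>2 - 60 * lam - 165)
                / (576 * (4 * lam\<^sup>2 - 12 * lam - 39))) \<and>
         (\<exists>f \<in> class_F0 lam.
            norm (hankel_log_2_1 f) =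
              (2 * lam + 1)\<^sup>2 * (12 * lam\<^sup>2 - 60 * lam - 165)
                / (576 * (4 * lam\<^sup>2 - 12 * lam - 39)))"
proof -
  \<comment> \<open>In terms of \<open>k\<close> the class condition reads
    \<open>Re (z f'' / f') > -k\<close>.\<close>
  define k where "k = lam + 1 / 2"
  have lam: "lam = k - 1 / 2" and k: "1 \<le> k" "k \<le> 3 / 2"
    using assms by (simp_all add: k_def)
  define d where "d = 8 + 4 * k - k\<^sup>2"
  have "k\<^sup>2 \<le> (3 / 2)\<^sup>2" using k by (intro power_mono) auto
  then have d: "0 < d" using k by (simp add: d_def power2_eq_square)
  define M where "M = 4 + (1 + k)\<^sup>2 / (8 + 4 * k - k\<^sup>2)"
  have M: "0 \<le> M" using d by (simp add: M_def d_def)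
  \<comment> \<open>The last factor of the numerator and the denominator are both negative; their
    signs cancel.\<close>
  have eqs: "(2 * lam + 1)\<^sup>2 = 4 * k\<^sup>2"
      "12 * lam\<^sup>2 - 60 * lam - 165 = - 4 * (4 * d + (1 + k)\<^sup>2)"
      "4 * lam\<^sup>2 - 12 * lam - 39 = - 4 * d"
    by (simp_all add: lam d_def power2_eq_square algebra_simps)
  have bound: "(2 * lam + 1)\<^sup>2 * (12 * lam\<^sup>2 - 60 * lam - 165) / (576 * (4 * lam\<^sup>2 - 12 * lam - 39))
      = k\<^sup>2 / 144 * M"
    unfolding eqs M_def d_def[symmetric] using d by (simp add: field_simps)
  have coeff: "norm ((of_real k)\<^sup>2 / 144 * G :: complex) = k\<^sup>2 / 144 * norm G" for G
    by (simp add: norm_mult norm_divide norm_power)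
  have "norm (hankel_log_2_1 f) \<le> k\<^sup>2 / 144 * M" if f: "f \<in> class_F0 lam" for f
  proof -
    obtain \<phi> where \<phi>: "\<phi> \<in> schur_class"
      and ode: "\<And>z. z \<in> unit_disk \<Longrightarrow>
        deriv (deriv f) z * (1 - z * \<phi> z) = 2 * of_real k * \<phi> z * deriv f z"
      using class_F0_imp_schur[of f k] f k unfolding lam by auto
    have "f \<in> class_A" using f by (simp add: class_F0_def)
    from hankel_log_2_1_eq[OF this \<phi> ode] show ?thesis
      using schur_functional_le[OF \<phi> k]
      by (simp only: coeff M_def) (rule mult_left_mono, auto)
  qed
  moreover have "\<exists>f \<in> class_F0 lam. norm (hankel_log_2_1 f) = k\<^sup>2 / 144 * M"
  proof -
    obtain \<phi> where \<phi>: "\<phi> \<in> schur_class" and val: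
      "let b = fps_nth (fps_expansion \<phi> 0) in
        6 * b 0 * b 2 - 4 * (b 1)\<^sup>2 + (4 + 2 * of_real k) * (b 0)\<^sup>2 * b 1
        + (2 + 2 * of_real k - (of_real k)\<^sup>2) * b 0 ^ 4 = - of_real M"
      using schur_functional_attained[OF k] unfolding M_def by blast
    obtain f where f: "f \<in> class_F0 lam"
      and ode: "\<And>z. z \<in> unit_disk \<Longrightarrow>
        deriv (deriv f) z * (1 - z * \<phi> z) = 2 * of_real k * \<phi> z * deriv f z"
      using schur_imp_class_F0[OF \<phi>, of k] k unfolding lam by auto
    have "f \<in> class_A" using f by (simp add: class_F0_def)
    from hankel_log_2_1_eq[OF this \<phi> ode] have "norm (hankel_log_2_1 f) = k\<^sup>2 / 144 * M"
      using M val by (simp only: coeff Let_def norm_minus_cancel norm_of_real abs_of_nonneg)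
    with f show ?thesis by blast
  qed
  ultimately show ?thesis unfolding bound by blast
qed

end
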